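(* (Layer Size Pruning) Given a support threshold $k$ and a candidate bipartite subgraph $g=(U(g),L(g),E(g),\Phi(g))$ of a bipartite graph $G_t$, the subgraph $g$ can be safely pruned if it satisfies the condition $$(|U(g)|-1)\cdot(|L(g)|-1)<k.$$
   Context: A bipartite graph $G=(U(G),L(G),E(G),\Phi(G))$ has two disjoint vertex sets $U(G)$ (users) and $L(G)$ (items), a set $E(G)$ of edges $e_{u,v}$ with $u\in U(G)$, $v\in L(G)$, and a mapping $\Phi(G):U(G)\times L(G)\to E(G)$. Each item $v$ has a keyword set $v.K$, and each edge $e_{u,v}$ has a weight $w_{u,v}$ (the frequency of interaction between user $u$ and item $v$). Subgraphs inherit weights and keyword sets. A wedge $\angle(u_i,v,u_j)$ is a path $u_i - v - u_j$ with $u_i,u_j$ users and $v$ an item; its weight is $\min\{w_{u_i,v},w_{u_j,v}\}$. A butterfly $\Join(u_i,u_j,v_a,v_b)$, with two users $u_i,u_j$ and two items $v_a,v_b$, is a complete bipartite subgraph containing the wedges $\angle(u_i,v_a,u_j)$ and $\angle(u_i,v_b,u_j)$; its score is the product of the weights of these two wedges. The support $sup(e)$ of an edge $e$ in a subgraph is the number of butterflies of that subgraph containing $e$. The user relationship score $score_{u_i,u_j}(g)$ is the sum of the scores of all butterflies of $g$ containing both $u_i$ and $u_j$ (each pair $\{v_a,v_b\}$ counted once). Given a center user $u_c\in U(G_t)$, a threshold $k$ of butterfly number, a maximum radius $r$ and a score threshold $\sigma$, a $(k,r,\sigma)$-bitruss is a connected subgraph $h$ of $G_t$ with $u_c\in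 h$ such that: (Support) every edge of $h$ has support at least $k$; (Radius) every user $u_i\in U(h)$ satisfies $dist(u_c,u_i)\le 2r$, where $dist$ is the shortest-path distance in $h$; (Score) for any two users $u_i,u_j$ in a wedge $\angle(u_i,v,u_j)$ of $h$, $score_{u_i,u_j}(h)\ge\sigma$. Given in addition a set $Q$ of query keywords, the CD-SBN problem (community detection over a streaming bipartite network, whose snapshot at time $t$ is $G_t$) asks for the subgraphs of $G_t$ that are $(k,r,\sigma)$-bitrusses and all of whose items $v$ satisfy $v.K\cap Q\neq\emptyset$; these are the CD-SBN answers. A candidate subgraph is a subgraph of $G_t$ under consideration in the search for answers. "Can be safely pruned" means that it can be discarded from this search because it cannot yield a CD-SBN answer.
   Formalization: "Safely pruned" is read as: no CD-SBN answer with at least one edge is contained in g. The single-vertex graph consisting of the center user alone satisfies every clause of an answer vacuously, so the literal claim fails for it. *)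

theory Defs
  imports "Graph_Theory.Graph_Theory"
begin

text \<open>The edge joining user \<open>u\<close> and item \<open>v\<close> is the pair \<open>(u, v)\<close>, so the map \<open>\<Phi>\<close> is pairing and the
  graph is simple. The values of \<open>weight\<close> outside \<open>edges\<close> and of \<open>keyword_set\<close> outside \<open>items\<close> are
  irrelevant.\<close>

record ('a, 'k) bipartite_graph =
  users :: "'a set"
  items :: "'a set"
  edges :: "('a \<times> 'a) set"
  weight :: "'a \<times> 'a \<Rightarrow> real"
  keyword_set :: "'a \<Rightarrow> 'k set"

definition wf_bipartite :: "('a, 'k) bipartite_graph \<Rightarrow> bool" where
  "wf_bipartite G \<longleftrightarrow>
     finite (users G) \<and> finite (items G) \<and> users G \<inter> items G = {} \<and> edges G \<subseteq> users G \<times> items G"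

definition bipartite_subgraph :: "('a, 'k) bipartite_graph \<Rightarrow> ('a, 'k) bipartite_graph \<Rightarrow> bool" where
  "bipartite_subgraph h G \<longleftrightarrow>
     wf_bipartite h \<and> users h \<subseteq> users G \<and> items h \<subseteq> items G \<and> edges h \<subseteq> edges G \<and>
     (\<forall>e\<in>edges h. weight h e = weight G e) \<and> (\<forall>v\<in>items h. keyword_set h v = keyword_set G v)"

definition wedge :: "('a, 'k) bipartite_graph \<Rightarrow> 'a \<Rightarrow> 'a \<Rightarrow> 'a \<Rightarrow> bool" where
  "wedge G u v u' \<longleftrightarrow> u \<noteq> u' \<and> (u, v) \<in> edges G \<and> (u', v) \<in> edges G"

definition wedge_weight :: "('a, 'k) bipartite_graph \<Rightarrow> 'a \<Rightarrow> 'a \<Rightarrow> 'a \<Rightarrow> real" where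
  "wedge_weight G u v u' = min (weight G (u, v)) (weight G (u', v))"

text \<open>A butterfly is represented by its set of two users and its set of two items, so that it is
  counted once irrespective of the order in which its vertices are listed.\<close>

definition butterflies :: "('a, 'k) bipartite_graph \<Rightarrow> ('a set \<times> 'a set) set" where
  "butterflies G = {({u, u'}, {v, v'}) | u u' v v'. v \<noteq> v' \<and> wedge G u v u' \<and> wedge G u v' u'}"

definition support :: "('a, 'k) bipartite_graph \<Rightarrow> 'a \<times> 'a \<Rightarrow> nat" where
  "support G e = card {(A, B). (A, B) \<in> butterflies G \<and> fst e \<in> A \<and> snd e \<in> B}"

text \<open>The product has two factors, one for each of the two wedges of the butterfly.\<close>

definition user_score :: "('a, 'k) bipartite_graph \<Rightarrow> 'a \<Rightarrow> 'a \<Rightarrow> real" where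
  "user_score G u u' = (\<Sum>B | ({u, u'}, B) \<in> butterflies G. \<Prod>v\<in>B. wedge_weight G u v u')"

definition to_digraph :: "('a, 'k) bipartite_graph \<Rightarrow> ('a, 'a \<times> 'a) pre_digraph" where
  "to_digraph G = with_proj \<lparr> pverts = users G \<union> items G, parcs = edges G \<union> (edges G)\<inverse> \<rparr>"

definition bdist :: "('a, 'k) bipartite_graph \<Rightarrow> 'a \<Rightarrow> 'a \<Rightarrow> ereal" where
  "bdist G x y = wf_digraph.\<mu> (to_digraph G) (\<lambda>_. 1) x y"

definition bitruss ::
    "('a, 'k) bipartite_graph \<Rightarrow> 'a \<Rightarrow> nat \<Rightarrow> nat \<Rightarrow> real \<Rightarrow> ('a, 'k) bipartite_graph \<Rightarrow> bool" where
  "bitruss G uc k r \<sigma> h \<longleftrightarrow>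
     bipartite_subgraph h G \<and> Digraph_Component.connected (to_digraph h) \<and> uc \<in> users h \<and>
     (\<forall>e\<in>edges h. k \<le> support h e) \<and>
     (\<forall>u\<in>users h. bdist h uc u \<le> ereal (2 * real r)) \<and>
     (\<forall>u v u'. wedge h u v u' \<longrightarrow> \<sigma> \<le> user_score h u u')"

definition cd_sbn_answer ::
    "('a, 'k) bipartite_graph \<Rightarrow> 'a \<Rightarrow> nat \<Rightarrow> nat \<Rightarrow> real \<Rightarrow> 'k set \<Rightarrow> ('a, 'k) bipartite_graph \<Rightarrow> bool"
  where
  "cd_sbn_answer G uc k r \<sigma> Q h \<longleftrightarrow>
     bitruss G uc k r \<sigma> h \<and> (\<forall>v\<in>items h. keyword_set h v \<inter> Q \<noteq> {})"

text \<open>The graph consisting of the center user alone satisfies every clause of \<open>cd_sbn_answer\<close>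
  vacuously, for all parameters, and lies in every subgraph containing the center. No pruning rule
  can exclude it, so pruning is about answers that have an edge.\<close>

definition safely_pruned ::
    "('a, 'k) bipartite_graph \<Rightarrow> 'a \<Rightarrow> nat \<Rightarrow> nat \<Rightarrow> real \<Rightarrow> 'k set \<Rightarrow> ('a, 'k) bipartite_graph \<Rightarrow> bool"
  where
  "safely_pruned G uc k r \<sigma> Q g \<longleftrightarrow>
     \<not> (\<exists>h. bipartite_subgraph h g \<and> edges h \<noteq> {} \<and> cd_sbn_answer G uc k r \<sigma> Q h)"

end

theory Submission
  imports Defs
begin

text \<open>A butterfly through a fixed edge \<open>(u, v)\<close> is determined by its other user
  and its other item, so the edge lies in at most (|U| - 1)(|L| - 1) butterflies; this is
  \<open>support_le\<close>. The bound can only grow from \<open>h\<close> to a larger graph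
  \<open>g\<close>. An answer inside \<open>g\<close> that has an edge therefore forces
  \<open>k\<close> to be at most the product formed from the layer sizes of \<open>g\<close>,
  against the assumed strict inequality.\<close>

lemma support_le:
  assumes wf: "wf_bipartite h" and e: "e \<in> edges h"
  shows "support h e \<le> (card (users h) - 1) * (card (items h) - 1)"
proof -
  obtain u v where uv: "e = (u, v)" by (cases e)
  have fin: "finite (users h)" "finite (items h)" and sub: "edges h \<subseteq> users h \<times> items h"
    using wf by (auto simp: wf_bipartite_def)
  have mem: "u \<in> users h" "v \<in> items h" using e uv sub by auto
  let ?P = "(users h - {u}) \<times> (items h - {v})"
  let ?S = "{(A, B). (A, B) \<in> butterflies h \<and> fst e \<in> A \<and> snd e \<in> B}"
  \<comment> \<open>Only an upper bound is wanted, so it suffices that the map from the remaining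
    user and item covers all butterflies through \<open>e\<close>.\<close>
  have "?S \<subseteq> (\<lambda>(u', v'). ({u, u'}, {v, v'})) ` ?P"
  proof clarify
    fix A B assume "(A, B) \<in> butterflies h" and in_AB: "fst e \<in> A" "snd e \<in> B"
    then obtain a a' b b' where AB: "A = {a, a'}" "B = {b, b'}" and "b \<noteq> b'" "a \<noteq> a'"
      and "(a, b) \<in> edges h" "(a', b') \<in> edges h"
      by (auto simp: butterflies_def wedge_def)
    \<comment> \<open>Two opposite edges of the butterfly touch all four of its vertices.\<close>
    then have "a \<in> users h" "a' \<in> users h" "b \<in> items h" "b' \<in> items h"
      using sub by auto
    \<comment> \<open>Which of \<open>a\<close>, \<open>a'\<close> equals \<open>u\<close> is
      unknown; \<open>u'\<close> is the other one, and \<open>v'\<close> is chosen likewise.\<close>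
    moreover obtain u' where "A = {u, u'}" "u' \<noteq> u" "u' \<in> {a, a'}"
      using in_AB AB \<open>a \<noteq> a'\<close> uv by auto
    moreover obtain v' where "B = {v, v'}" "v' \<noteq> v" "v' \<in> {b, b'}"
      using in_AB AB \<open>b \<noteq> b'\<close> uv by auto
    ultimately show "(A, B) \<in> (\<lambda>(u', v'). ({u, u'}, {v, v'})) ` ?P"
      by (intro image_eqI[of _ _ "(u', v')"]) auto
  qed
  then have "support h e \<le> card ?P"
    unfolding support_def using fin by (intro surj_card_le) auto
  also have "\<dots> = (card (users h) - 1) * (card (items h) - 1)"
    using fin mem by (simp add: card_cartesian_product)
  finally show ?thesis .
qed

theorem lemma3:
  fixes G g :: "('a, 'k) bipartite_graph"
    and uc :: 'a and k r :: nat and \<sigma> :: real and Q :: "'k set"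
  assumes "wf_bipartite G"
    and "uc \<in> users G"
    and "bipartite_subgraph g G"
    and "(int (card (users g)) - 1) * (int (card (items g)) - 1) < int k"
  shows "safely_pruned G uc k r \<sigma> Q g"
  unfolding safely_pruned_def
proof
  assume "\<exists>h. bipartite_subgraph h g \<and> edges h \<noteq> {} \<and> cd_sbn_answer G uc k r \<sigma> Q h"
  then obtain h e where h: "bipartite_subgraph h g" and e: "e \<in> edges h" and "k \<le> support h e"
    by (auto simp: cd_sbn_answer_def bitruss_def)
  note this(3)
  also have "support h e \<le> (card (users h) - 1) * (card (items h) - 1)"
    using h by (intro support_le[OF _ e]) (simp add: bipartite_subgraph_def)
  also have "\<dots> \<le> (card (users g) - 1) * (card (items g) - 1)"
    using h assms(3)
    by (intro mult_le_mono diff_le_mono card_mono) (auto simp: bipartite_subgraph_def wf_bipartite_def)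
  finally have "int k \<le> int (card (users g) - 1) * int (card (items g) - 1)"
    by (simp flip: of_nat_mult)
  \<comment> \<open>The bound so far uses truncated subtraction on naturals, the hypothesis integer
    subtraction. They agree because the endpoints of \<open>e\<close> make both layers of
    \<open>g\<close> nonempty.\<close>
  moreover have "card (users g) \<noteq> 0" "card (items g) \<noteq> 0"
    using h e assms(3) by (auto simp: bipartite_subgraph_def wf_bipartite_def)
  ultimately show False
    using assms(4) by (simp add: of_nat_diff Suc_le_eq)
qed

end
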